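(* Let $x\in\Sigma_q^n$ and $\ell\ge2$. Suppose that $\mathcal R'$ is obtained from $\mathcal R_\ell(\tilde x)=(s_0,\dots,s_{n+\ell})$ by deleting the $\ell$-mers with indices $i_j+1,\dots,i_j+t_j$ for $j=1,\dots,k$, where $t_1,\dots,t_k\ge1$, $0\le i_1$, $i_k+t_k<n+\ell$, and $i_{j+1}-i_j\ge t_j+2$ for all $1\le j<k$. Let $t=\sum_{j=1}^k t_j$, write $\mathcal R'=(s'_0,s'_1,\dots,s'_{n+\ell-t})$, and let $m_j=\sum_{r=1}^{j-1}t_r$ for $1\le j\le k$. (i) There are $k$ integers $\sigma_1,\dots,\sigma_k$ with $0\le \sigma_j\le\min\{\ell-1,t_j\}$ for each $j$, such that inserting $\sigma_j$ $\ell$-mers between $s'_{i_j-m_j}$ and $s'_{i_j-m_j+1}$ (for each $j$) yields a consistent vector $\mathcal R''$ of $\ell$-mers. These integers can be determined directly from $\mathcal R'$. The sequence $\mathcal R_\ell^{-1}(\mathcal R'')$ is obtained from $\tilde x$ by deleting the $k$ substrings $\tilde x_{[i_1+1,\,i_1+t_1-\sigma_1]},\dots,\tilde x_{[i_k+1,\,i_k+t_k-\sigma_k]}$. (ii) If $\sigma_j<\min\{\ell-1,t_j\}$, then $\tilde x_{[i_j+1,\,i_j+t_j-\sigma_j]}$ is contained in a maximal periodic substring of length at least $\ell-1+t_j-2\sigma_j$ whose minimum period is at most $t_j-\sigma_j$. (iii) If $\sigma_j<t_j\le\ell-2$, the minimum period of the maximal periodic substring in (ii) divides $t_j-\sigm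a_j$.
   Context: $q\ge2$, $\Sigma_q=\{0,1,\dots,q-1\}$; $z_{[a,b]}=z_az_{a+1}\cdots z_b$ denotes a substring (empty if $b<a$). An $\ell$-mer is an element of $\Sigma_q^\ell$. Channel: two known $\ell$-mers $u,v\in\Sigma_q^\ell$ are fixed, and $\tilde x=uxv$, with coordinates indexed by $-\ell+1,\dots,n+\ell$, so that $\tilde x_{[-\ell+1,0]}=u$, $\tilde x_{[1,n]}=x$, $\tilde x_{[n+1,n+\ell]}=v$. The read vector is $\mathcal R_\ell(\tilde x)=(s_0,s_1,\dots,s_{n+\ell})$ with $s_i=\tilde x_{[i-\ell+1,i]}$. The first and last $\ell$-mers $s_0$ and $s_{n+\ell}$ are assumed not to be deleted. Consistency: two $\ell$-mers $y_1\cdots y_\ell$ and $z_1\cdots z_\ell$ (in this order) are consistent if $y_2\cdots y_\ell=z_1\cdots z_{\ell-1}$. A vector of $\ell$-mers is consistent if every two adjacent entries are consistent. For a consistent vector $(r_1,\dots,r_m)$ with $r_i=r_{i,1}\cdots r_{i,\ell}$, $\mathcal R_\ell^{-1}(r_1,\dots,r_m)$ denotes the sequence $r_{1,1}\cdots r_{1,\ell}r_{2,\ell}\cdots r_{m,\ell}$. Periodicity: a sequence $z$ of length at least $T+1$ is $T$-periodic (has period $T$) if $z_i=z_{i+T}$ for all $1\le i\le |z|-T$; its minimum period is its smallest period. A maximal $T$-periodic substring of $z$ is a $T$-periodic substring not contained in a longer $T$-periodic substring of $z$; "maximal periodic substring with minimum period $T$" means a maximal $T$-periodic substring whose minimum period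 is $T$. If several of the deleted substrings lie in the same maximal periodic substring, the deletions are interpreted as sequentially applied to it, and (ii) says that before each such deletion the maximal periodic substring has length at least $\ell-1+t_j-2\sigma_j$. *)

theory Defs
  imports Main
begin

definition words :: "nat \<Rightarrow> nat \<Rightarrow> nat list set" where
  "words q n = {w. length w = n \<and> set w \<subseteq> {..<q}}"

text \<open>The paper's coordinates \<open>-l+1, \<dots>, n+l\<close> of \<open>u x v\<close> are shifted to list positions:
  coordinate \<open>c\<close> is position \<open>c + l - 1\<close> of \<open>u @ x @ v\<close>.  Hence the read \<open>s\<^sub>e\<close>, which occupies the
  coordinates \<open>e-l+1, \<dots>, e\<close>, starts at position \<open>e\<close>, and it is the entry \<open>e\<close> of the read vector.\<close>

definition reads :: "nat \<Rightarrow> nat list \<Rightarrow> nat list list" where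
  "reads l z = map (\<lambda>e. take l (drop e z)) [0..<length z - l + 1]"

definition consistent :: "nat list list \<Rightarrow> bool" where
  "consistent R \<longleftrightarrow> successively (\<lambda>y z. tl y = butlast z) R"

fun unread :: "nat list list \<Rightarrow> nat list" where
  "unread [] = []"
| "unread (r # rs) = r @ map last rs"

definition delete_positions :: "'a list \<Rightarrow> nat set \<Rightarrow> 'a list" where
  "delete_positions z A = nths z (- A)"

text \<open>\<open>R''\<close> arises from \<open>R\<close> by inserting, for each \<open>p\<close>, some \<open>c p\<close> many \<open>l\<close>-mers directly after
  the entry \<open>R ! p\<close>.\<close>

definition insertion ::
    "nat \<Rightarrow> nat \<Rightarrow> (nat \<Rightarrow> nat) \<Rightarrow> nat list list \<Rightarrow> nat list list \<Rightarrow> bool" where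
  "insertion q l c R R'' \<longleftrightarrow>
     (\<exists>W. (\<forall>p<length R. length (W p) = c p \<and> set (W p) \<subseteq> words q l) \<and>
          R'' = concat (map (\<lambda>p. R ! p # W p) [0..<length R]))"

text \<open>\<open>substr z a b\<close> occupies the half-open range of positions \<open>a, \<dots>, b-1\<close>.\<close>

definition substr :: "'a list \<Rightarrow> nat \<Rightarrow> nat \<Rightarrow> 'a list" where
  "substr z a b = take (b - a) (drop a z)"

definition periodic :: "nat \<Rightarrow> 'a list \<Rightarrow> bool" where
  "periodic T z \<longleftrightarrow> 1 \<le> T \<and> T + 1 \<le> length z \<and> (\<forall>p. p + T < length z \<longrightarrow> z ! p = z ! (p + T))"

definition min_period :: "nat \<Rightarrow> 'a list \<Rightarrow> bool" where
  "min_period T z \<longleftrightarrow> periodic T z \<and> (\<forall>T'. periodic T' z \<longrightarrow> T \<le> T')"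

definition maximal_periodic :: "'a list \<Rightarrow> nat \<Rightarrow> nat \<Rightarrow> nat \<Rightarrow> bool" where
  "maximal_periodic z T a b \<longleftrightarrow>
     a \<le> b \<and> b \<le> length z \<and> periodic T (substr z a b) \<and>
     (\<forall>a' b'. a' \<le> a \<and> b \<le> b' \<and> b' \<le> length z \<and> periodic T (substr z a' b') \<longrightarrow> a' = a \<and> b' = b)"

text \<open>The positions of the substring with coordinates \<open>i\<^sub>j+1, \<dots>, i\<^sub>j+t\<^sub>j-\<sigma>\<^sub>j\<close>.\<close>

definition block :: "nat \<Rightarrow> (nat \<Rightarrow> nat) \<Rightarrow> (nat \<Rightarrow> nat) \<Rightarrow> (nat \<Rightarrow> nat) \<Rightarrow> nat \<Rightarrow> nat set" where
  "block l i t \<sigma> j = {i j + l ..< i j + l + (t j - \<sigma> j)}"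

text \<open>The sequence \<open>z\<close> after the deletion of the substrings with indices in \<open>J\<close> only, and the position
  in it at which the substring with index \<open>j \<notin> J\<close> then starts.  They describe the intermediate
  states when the deletions are applied one after the other.\<close>

definition delete_blocks ::
    "nat \<Rightarrow> (nat \<Rightarrow> nat) \<Rightarrow> (nat \<Rightarrow> nat) \<Rightarrow> (nat \<Rightarrow> nat) \<Rightarrow> nat set \<Rightarrow> nat list \<Rightarrow> nat list" where
  "delete_blocks l i t \<sigma> J z = delete_positions z (\<Union>j\<in>J. block l i t \<sigma> j)"

definition block_start ::
    "nat \<Rightarrow> (nat \<Rightarrow> nat) \<Rightarrow> (nat \<Rightarrow> nat) \<Rightarrow> (nat \<Rightarrow> nat) \<Rightarrow> nat set \<Rightarrow> nat \<Rightarrow> nat" where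
  "block_start l i t \<sigma> J j = i j + l - (\<Sum>r | r \<in> J \<and> r < j. t r - \<sigma> r)"

end

(* Between two adjacent reads insert as few l-mers as consistency allows, that is, overlap the two
   reads as much as possible.  At a run of t deleted reads, let \<sigma> be the number of inserted l-mers.
   The decoded sequence is obtained by gluing the remaining reads along these overlaps; the letters
   lost at the run are the t - \<sigma> letters of the block.  If \<sigma> < min (l - 1) t, the overlap says that
   l - 1 - \<sigma> letters of the original sequence recur at distance t - \<sigma>, so the factor from the
   first occurrence to the end of the block has period t - \<sigma>.  Its minimum period T is also that of
   its maximal T-periodic extension, and T divides t - \<sigma> by a weak form of the Fine-Wilf theorem
   when t \<le> l - 2.  Deleting other blocks keeps every read outside their runs intact, hence also the
   factor formed by all the reads from just before the run to just after it. *)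

theory Submission
  imports Defs
begin

section \<open>Largest overlaps of adjacent reads and gluing along them\<close>

text \<open>With s reads between them, the second read is shifted by s + 1 against the first, whence
  the \<open>Suc\<close>. The least s corresponds to the largest overlap.\<close>

definition gap :: "nat \<Rightarrow> nat list \<Rightarrow> nat list \<Rightarrow> nat" where
  "gap l y z = (LEAST s. drop (Suc s) y = take (l - Suc s) z)"

lemma gap_le:
  assumes "drop (Suc s) y = take (l - Suc s) z"
  shows "gap l y z \<le> s"
  unfolding gap_def using assms by (rule Least_le)

lemma gap_overlap:
  assumes "length y = l"
  shows "drop (Suc (gap l y z)) y = take (l - Suc (gap l y z)) z"
  \<comment> \<open>At \<open>l\<close> both sides are empty, so a least value exists.\<close>
  unfolding gap_def by (rule LeastI[where k = l]) (use assms in simp)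

lemma gap_less:
  assumes "length y = l" "1 \<le> l"
  shows "gap l y z < l"
  using gap_le[of "l - 1" y l z] assms by simp

text \<open>Only the received reads enter here, so these numbers are determined by the received
  vector. The value 0 at the last entry means that nothing is inserted after it.\<close>

definition gaps :: "nat \<Rightarrow> nat list list \<Rightarrow> nat \<Rightarrow> nat" where
  "gaps l R p = (if Suc p < length R then gap l (R ! p) (R ! Suc p) else 0)"

text \<open>Each read loses the tail that overlaps the next one.\<close>

fun merge :: "nat \<Rightarrow> nat list list \<Rightarrow> nat list" where
  "merge l [] = []"
| "merge l [r] = r"
| "merge l (r # r' # R) = take (Suc (gap l r r')) r @ merge l (r' # R)"

lemma take_gap_append:
  assumes "length y = l"
  shows "take (Suc (gap l y z)) y @ z = y @ drop (l - Suc (gap l y z)) z"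
  by (metis append.assoc append_take_drop_id gap_overlap[OF assms])

text \<open>\<open>merge\<close> recurses from the left, whereas the later induction over the
  surviving reads adds a read on the right.\<close>

lemma merge_snoc:
  assumes "length r = l"
  shows "merge l (R @ [r, r']) = merge l (R @ [r]) @ drop (l - Suc (gap l r r')) r'"
proof (induction R)
  case Nil
  then show ?case by (simp add: take_gap_append assms)
next
  case (Cons a R)
  then show ?case by (cases R) auto
qed

lemma merge_snoc_suffix: "\<exists>w. merge l (R @ [r]) = w @ r"
proof (induction R)
  case (Cons a R)
  then show ?case by (cases R) auto
qed simp

lemma gaps_Cons: "gaps l (r # R) (Suc p) = gaps l R p"
  by (simp add: gaps_def)

section \<open>Existence and decoding of consistent insertions\<close>

lemma insertion_Nil: "insertion q l c [] R'' \<longleftrightarrow> R'' = []"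
  by (simp add: insertion_def)

text \<open>Replaces the indexed family \<open>W\<close> by a recursion along the list, which opens
  both existence and decoding to induction.\<close>

lemma insertion_Cons:
  "insertion q l c (r # R) R'' \<longleftrightarrow>
     (\<exists>w R0. length w = c 0 \<and> set w \<subseteq> words q l \<and>
        insertion q l (\<lambda>p. c (Suc p)) R R0 \<and> R'' = r # w @ R0)"
  (is "?lhs \<longleftrightarrow> ?rhs")
proof
  have split: "concat (map (\<lambda>p. (r # R) ! p # W p) [0..<length (r # R)]) =
    r # W 0 @ concat (map (\<lambda>p. R ! p # W (Suc p)) [0..<length R])" for W :: "nat \<Rightarrow> nat list list"
    by (simp add: upt_conv_Cons map_Suc_upt[symmetric] comp_def del: upt_Suc)
  show ?rhs if ?lhs
  proof -
    from that obtain W where W: "\<forall>p<length (r # R). length (W p) = c p \<and> set (W p) \<subseteq> words q l"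
      and R'': "R'' = concat (map (\<lambda>p. (r # R) ! p # W p) [0..<length (r # R)])"
      unfolding insertion_def by blast
    have "insertion q l (\<lambda>p. c (Suc p)) R (concat (map (\<lambda>p. R ! p # W (Suc p)) [0..<length R]))"
      unfolding insertion_def using W by (intro exI[of _ "\<lambda>p. W (Suc p)"]) auto
    then show ?rhs
      using W R'' unfolding split by blast
  qed
  show ?lhs if ?rhs
  proof -
    from that obtain w W where w: "length w = c 0" "set w \<subseteq> words q l"
      and W: "\<forall>p<length R. length (W p) = c (Suc p) \<and> set (W p) \<subseteq> words q l"
      and R'': "R'' = r # w @ concat (map (\<lambda>p. R ! p # W p) [0..<length R])"
      unfolding insertion_def by blast
    have "\<forall>p<length (r # R). length (case_nat w W p) = c p \<and> set (case_nat w W p) \<subseteq> words q l"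
      using w W by (auto split: nat.split)
    moreover have "R'' = concat (map (\<lambda>p. (r # R) ! p # case_nat w W p) [0..<length (r # R)])"
      unfolding split R'' by simp
    ultimately show ?lhs unfolding insertion_def by blast
  qed
qed

text \<open>Each consistent step shifts by one letter, so the path spells a word whose last
  \<open>l\<close> letters are \<open>r'\<close>. The letters before these lie in \<open>r\<close>
  because \<open>length w < l\<close>.\<close>

lemma consistent_path:
  assumes "consistent (r # w @ [r'])" "\<forall>y\<in>set (r # w @ [r']). length y = l" "length w < l"
  shows "r @ map last w @ [last r'] = take (Suc (length w)) r @ r'"
  using assms
proof (induction w arbitrary: r)
  case Nil
  then have "tl r = butlast r'" "r \<noteq> []" "r' \<noteq> []"
    by (auto simp: consistent_def)
  then show ?case
    by (cases r) auto
next
  case (Cons a w)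
  have IH: "a @ map last w @ [last r'] = take (Suc (length w)) a @ r'"
    by (rule Cons.IH) (use Cons.prems in \<open>auto simp: consistent_def\<close>)
  have tl: "tl r = butlast a" and len: "length a = l" "length r = l" "Suc (length w) < l"
    using Cons.prems by (auto simp: consistent_def)
  then obtain b where r: "r = b # butlast a" by (cases r) auto
  have a: "a \<noteq> []" using len by auto
  have "r @ map last (a # w) @ [last r'] = b # (butlast a @ [last a]) @ map last w @ [last r']"
    using r by simp
  also have "\<dots> = b # a @ map last w @ [last r']"
    using a by simp
  also have "\<dots> = b # take (Suc (length w)) (butlast a) @ r'"
    using IH len by (simp add: take_butlast)
  finally show ?case using r by simp
qed

lemma consistent_append_Cons:
  "consistent (R @ r # R') \<longleftrightarrow> consistent (R @ [r]) \<and> consistent (r # R')"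
  by (auto simp: consistent_def successively_append_iff)

lemma insertion_Cons_starts: "insertion q l c (r # R) R'' \<Longrightarrow> \<exists>R0. R'' = r # R0"
  by (auto simp: insertion_Cons)

text \<open>By \<open>consistent_path\<close>, what is decoded between two adjacent reads depends
  only on these reads and on the number of \<open>l\<close>-mers inserted. Hence all consistent
  choices of these \<open>l\<close>-mers decode alike.\<close>

lemma unread_insertion:
  assumes "insertion q l (gaps l R) R R''" "consistent R''"
    "\<forall>y\<in>set R. length y = l" "1 \<le> l"
  shows "unread R'' = merge l R"
  using assms
proof (induction R arbitrary: R'')
  case Nil
  then show ?case by (simp add: insertion_Nil)
next
  case (Cons r R)
  from Cons.prems(1) obtain w R0 where w: "length w = gaps l (r # R) 0" "set w \<subseteq> words q l"
    and R0: "insertion q l (gaps l R) R R0" and R'': "R'' = r # w @ R0"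
    unfolding insertion_Cons gaps_Cons by blast
  show ?case
  proof (cases R)
    case Nil
    then show ?thesis using w R0 R'' by (simp add: gaps_def insertion_Nil)
  next
    case (Cons r' R1)
    with R0 obtain R2 where R2: "R0 = r' # R2"
      using insertion_Cons_starts by blast
    have w': "length w = gap l r r'"
      using w Cons by (simp add: gaps_def)
    have "consistent R0" and path: "consistent (r # w @ [r'])"
      using Cons.prems(2) consistent_append_Cons[of "r # w" r' R2] unfolding R'' R2 by auto
    then have IH: "unread R0 = merge l R"
      using Cons.IH R0 Cons.prems by simp
    have "length w < l"
      unfolding w' by (rule gap_less) (use Cons.prems in auto)
    then have "r @ map last w @ [last r'] = take (Suc (length w)) r @ r'"
      by (intro consistent_path[OF path]) (use Cons.prems Cons w in \<open>auto simp: words_def\<close>)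
    then have "unread R'' = take (Suc (length w)) r @ unread R0"
      unfolding R'' R2 by simp
    then show ?thesis using IH Cons w' by simp
  qed
qed

lemma consistent_reads:
  assumes "1 \<le> l" "l \<le> length z"
  shows "consistent (reads l z)"
  unfolding consistent_def successively_conv_nth
proof (intro allI impI)
  fix e assume e: "Suc e < length (reads l z)"
  then have "butlast (take l (drop (Suc e) z)) = take (l - 1) (drop (Suc e) z)"
    using assms by (intro butlast_take) (simp add: reads_def)
  then show "tl (reads l z ! e) = butlast (reads l z ! Suc e)"
    using e by (simp add: reads_def tl_take tl_drop drop_Suc del: upt_Suc)
qed

lemma reads_split:
  assumes "length z = l + Suc m"
  shows "reads l z = take l z # map (\<lambda>e. take l (drop e z)) [1..<Suc m] @ [drop (Suc m) z]"
proof -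
  have "[0..<length z - l + 1] = 0 # [1..<Suc m] @ [Suc m]"
    using assms by (simp add: upt_conv_Cons)
  then show ?thesis
    unfolding reads_def by (simp add: assms)
qed

text \<open>The \<open>l\<close>-mers to insert are the inner windows of the word that glues two
  adjacent reads along their overlap. Consistency is inherited from the reads of that word.\<close>

lemma consistent_insertion_exists:
  assumes "set R \<subseteq> words q l" "1 \<le> l"
  shows "\<exists>R''. insertion q l (gaps l R) R R'' \<and> consistent R''"
  using assms
proof (induction R)
  case Nil
  then show ?case by (simp add: insertion_Nil consistent_def)
next
  case (Cons r R)
  then obtain R0 where R0: "insertion q l (gaps l R) R R0" "consistent R0" by auto
  show ?case
  proof (cases R)
    case Nil
    then show ?thesis
      by (auto simp: insertion_Cons insertion_Nil gaps_def consistent_def)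
  next
    case (Cons r' R1)
    with R0 obtain R2 where R2: "R0 = r' # R2"
      using insertion_Cons_starts by blast
    define m where "m = gap l r r'"
    define z where "z = take (Suc m) r @ r'"
    define w where "w = map (\<lambda>e. take l (drop e z)) [1..<Suc m]"
    have len: "length r = l" "length r' = l" and sub: "set r \<subseteq> {..<q}" "set r' \<subseteq> {..<q}"
      using Cons.prems Cons by (auto simp: words_def)
    have m: "m < l" unfolding m_def using gap_less len Cons.prems by simp
    have z: "length z = l + Suc m" "set z \<subseteq> {..<q}"
      using len m sub by (auto simp: z_def dest: in_set_takeD)
    \<comment> \<open>The overlap makes \<open>r\<close> a prefix of \<open>z\<close>; that
      \<open>r'\<close> is a suffix holds by definition.\<close>
    have zr: "z = r @ drop (l - Suc m) r'"
      unfolding z_def m_def using take_gap_append len by blast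
    have "reads l z = r # w @ [r']"
      unfolding reads_split[OF z(1)] w_def
      using len m arg_cong[OF zr, of "take l"] arg_cong[OF z_def, of "drop (Suc m)"] by simp
    then have "consistent (r # w @ [r'])"
      using consistent_reads[of l z] z Cons.prems by simp
    then have "consistent (r # w @ R0)"
      using R0(2) consistent_append_Cons[of "r # w" r' R2] unfolding R2 by auto
    moreover have "length w = gaps l (r # R) 0"
      using Cons by (simp add: w_def gaps_def m_def)
    moreover have "set w \<subseteq> words q l"
      using z by (auto simp: w_def words_def dest!: in_set_takeD in_set_dropD)
    ultimately show ?thesis
      using R0(1) unfolding insertion_Cons gaps_Cons by blast
  qed
qed

section \<open>Deleting positions from a list\<close>

text \<open>Together with the next lemma this evaluates a deletion interval by interval along
  growing prefixes.\<close>

lemma delete_positions_take_keep: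
  assumes "{a..<b} \<inter> A = {}" "a \<le> b" "b \<le> length xs"
  shows "delete_positions (take b xs) A = delete_positions (take a xs) A @ take (b - a) (drop a xs)"
proof -
  have "take b xs = take a xs @ take (b - a) (drop a xs)"
    using assms by (metis le_add_diff_inverse take_add)
  \<comment> \<open>\<open>nths_append\<close> shifts the index set of the second part by
    \<open>a\<close>, the length of the first.\<close>
  moreover have "{j. j + a \<notin> A} \<supseteq> {..<b - a}"
    using assms by (auto simp: disjoint_iff)
  ultimately show ?thesis
    using assms unfolding delete_positions_def
    by (auto simp: nths_append min_absorb2 intro!: nths_all)
qed

lemma delete_positions_take_remove:
  assumes "{a..<b} \<subseteq> A" "a \<le> b" "b \<le> length xs"
  shows "delete_positions (take b xs) A = delete_positions (take a xs) A"
proof -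
  have "take b xs = take a xs @ take (b - a) (drop a xs)"
    using assms by (metis le_add_diff_inverse take_add)
  moreover have "nths (take (b - a) (drop a xs)) {j. j + a \<notin> A} = []"
    using assms by (subst length_0_conv[symmetric]) (auto simp: length_nths)
  ultimately show ?thesis
    using assms unfolding delete_positions_def
    by (auto simp: nths_append min_absorb2)
qed

lemma delete_positions_take_prefix:
  "\<exists>w. delete_positions xs A = delete_positions (take a xs) A @ w"
  unfolding delete_positions_def
  by (metis append_take_drop_id nths_append)

lemma length_delete_positions_take:
  assumes "a \<le> length xs"
  shows "length (delete_positions (take a xs) A) = a - card (A \<inter> {..<a})"
proof -
  have "{p. p < length (take a xs) \<and> p \<in> - A} = {..<a} - (A \<inter> {..<a})"
    using assms by auto
  then show ?thesis
    unfolding delete_positions_def length_nths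
    by (simp add: card_Diff_subset)
qed

text \<open>The survivors among the first \<open>e\<close> entries form a prefix of exactly this
  length, and \<open>xs ! e\<close> comes next.\<close>

lemma delete_positions_nth:
  assumes "e < length xs" "e \<notin> A"
  shows "e - card (A \<inter> {..<e}) < length (delete_positions xs A)"
    and "delete_positions xs A ! (e - card (A \<inter> {..<e})) = xs ! e"
proof -
  have "delete_positions (take (Suc e) xs) A = delete_positions (take e xs) A @ [xs ! e]"
    using delete_positions_take_keep[of e "Suc e" A xs] assms by (simp add: take_Suc_conv_app_nth hd_drop_conv_nth take_Suc)
  moreover obtain w where "delete_positions xs A = delete_positions (take (Suc e) xs) A @ w"
    using delete_positions_take_prefix by blast
  ultimately have "delete_positions xs A = delete_positions (take e xs) A @ xs ! e # w"
    by simp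
  then show "e - card (A \<inter> {..<e}) < length (delete_positions xs A)"
    "delete_positions xs A ! (e - card (A \<inter> {..<e})) = xs ! e"
    using length_delete_positions_take[of e xs A] assms by (simp_all add: nth_append)
qed

lemma delete_positions_index:
  assumes "p < length (delete_positions xs A)"
  obtains e where "e < length xs" "e \<notin> A" "p = e - card (A \<inter> {..<e})"
proof -
  have "\<exists>e<length xs. e \<notin> A \<and> p = e - card (A \<inter> {..<e})"
    using assms
  proof (induction xs rule: rev_induct)
    case Nil
    then show ?case by (simp add: delete_positions_def)
  next
    case (snoc x xs)
    have len: "length (delete_positions xs A) = length xs - card (A \<inter> {..<length xs})"
      using length_delete_positions_take[of "length xs" xs A] by simp
    have "delete_positions (xs @ [x]) A = delete_positions xs A @ (if length xs \<in> A then [] else [x])"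
      unfolding delete_positions_def nths_append by simp
    then show ?case
      using snoc len by (cases "p < length (delete_positions xs A)") (auto simp: less_Suc_eq split: if_splits)
  qed
  then show thesis using that by blast
qed

section \<open>Periods of substrings\<close>

lemma length_substr: "b \<le> length z \<Longrightarrow> length (substr z a b) = b - a"
  by (simp add: substr_def)

lemma substr_nth: "b \<le> length z \<Longrightarrow> p < b - a \<Longrightarrow> substr z a b ! p = z ! (a + p)"
  by (simp add: substr_def)

text \<open>In positions of the ambient sequence, periods of nested substrings can be compared
  directly.\<close>

lemma periodic_substr_iff:
  assumes "a \<le> b" "b \<le> length z"
  shows "periodic T (substr z a b) \<longleftrightarrow>
    1 \<le> T \<and> a + T < b \<and> (\<forall>p. a \<le> p \<and> p + T < b \<longrightarrow> z ! p = z ! (p + T))"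
proof -
  have "(\<forall>p. p + T < b - a \<longrightarrow> substr z a b ! p = substr z a b ! (p + T)) \<longleftrightarrow>
    (\<forall>p. a \<le> p \<and> p + T < b \<longrightarrow> z ! p = z ! (p + T))" (is "?l \<longleftrightarrow> ?r")
  proof
    assume ?l
    show ?r
    proof (intro allI impI)
      fix p assume p: "a \<le> p \<and> p + T < b"
      then have "substr z a b ! (p - a) = substr z a b ! (p + T - a)"
        using \<open>?l\<close> by auto
      then show "z ! p = z ! (p + T)"
        using p assms substr_nth[of b z "p - a" a] substr_nth[of b z "p + T - a" a]
        by (auto simp: diff_less_mono)
    qed
  qed (use assms in \<open>simp add: substr_nth add.assoc\<close>)
  then show ?thesis
    using assms unfolding periodic_def by (auto simp: length_substr)
qed

lemma min_period_exists:
  assumes "periodic T z"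
  obtains T' where "min_period T' z" "T' \<le> T"
proof (rule that[of "LEAST T. periodic T z"])
  show "min_period (LEAST T. periodic T z) z"
    unfolding min_period_def using LeastI[of "\<lambda>T. periodic T z", OF assms]
    by (simp add: Least_le)
  show "(LEAST T. periodic T z) \<le> T"
    using assms by (rule Least_le)
qed

text \<open>A longest interval of period \<open>T\<close> around the given one is maximal. A smaller
  period of it would restrict to the original substring.\<close>

lemma min_period_extend:
  assumes "min_period T (substr z a b)" "a \<le> b" "b \<le> length z"
  obtains a' b' where "maximal_periodic z T a' b'" "min_period T (substr z a' b')" "a' \<le> a" "b \<le> b'"
proof -
  define P where "P = (\<lambda>(a', b'). a' \<le> a \<and> b \<le> b' \<and> b' \<le> length z \<and> periodic T (substr z a' b'))"
  have "P (a, b)" using assms by (auto simp: P_def min_period_def)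
  moreover have "\<forall>y. P y \<longrightarrow> snd y - fst y < Suc (length z)" by (auto simp: P_def)
  ultimately have "\<exists>y. P y \<and> (\<forall>y'. P y' \<longrightarrow> snd y' - fst y' \<le> snd y - fst y)"
    by (rule ex_has_greatest_nat)
  then obtain y where "P y" "\<forall>y'. P y' \<longrightarrow> snd y' - fst y' \<le> snd y - fst y"
    by blast
  then obtain a' b' where P: "P (a', b')" and max: "\<And>y. P y \<Longrightarrow> snd y - fst y \<le> b' - a'"
    by (cases y) simp
  have ab: "a' \<le> a" "b \<le> b'" "b' \<le> length z" and per: "periodic T (substr z a' b')"
    using P by (auto simp: P_def)
  have "maximal_periodic z T a' b'"
    unfolding maximal_periodic_def
  proof (intro conjI allI impI)
    fix a'' b'' assume "a'' \<le> a' \<and> b' \<le> b'' \<and> b'' \<le> length z \<and> periodic T (substr z a'' b'')"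
    moreover from this have "b'' - a'' \<le> b' - a'"
      using max[of "(a'', b'')"] ab by (auto simp: P_def)
    ultimately show "a'' = a'" "b'' = b'" using ab assms by auto
  qed (use ab per assms in auto)
  moreover have "T \<le> T'" if "periodic T' (substr z a' b')" for T'
  proof (rule ccontr)
    assume "\<not> T \<le> T'"
    \<comment> \<open>The original substring is longer than \<open>T\<close>, hence long enough to
      have the smaller period \<open>T'\<close>.\<close>
    moreover have "a + T < b"
      using assms periodic_substr_iff by (auto simp: min_period_def)
    ultimately have "periodic T' (substr z a b)"
      using that assms ab by (auto simp: periodic_substr_iff)
    then show False
      using assms \<open>\<not> T \<le> T'\<close> by (auto simp: min_period_def)
  qed
  ultimately show thesis
    using that ab per by (auto simp: min_period_def)
qed

lemma periodic_mult:
  assumes "periodic T z" "p + c * T < length z"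
  shows "z ! p = z ! (p + c * T)"
  using assms(2)
proof (induction c)
  case (Suc c)
  then have "z ! (p + c * T) = z ! (p + c * T + T)"
    using assms(1) by (auto simp: periodic_def algebra_simps)
  then show ?case using Suc by (simp add: algebra_simps)
qed simp

text \<open>The easy case of Fine and Wilf: the remainder of \<open>T'\<close> modulo \<open>T\<close> is again a period, since at
  each position one can go forward by \<open>T'\<close> before going back by a multiple of \<open>T\<close>, or vice versa.\<close>

lemma min_period_dvd:
  assumes "min_period T z" "periodic T' z" "2 * T' \<le> length z"
  shows "T dvd T'"
proof (rule ccontr)
  define r c where "r = T' mod T" and "c = T' div T"
  assume "\<not> T dvd T'"
  then have r: "0 < r" by (simp add: r_def dvd_eq_mod_eq_0)
  have T: "periodic T z" "1 \<le> T" "T \<le> T'"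
    using assms by (auto simp: min_period_def periodic_def)
  have T': "T' = c * T + r" by (simp add: r_def c_def)
  have rT: "r < T" using T by (simp add: r_def)
  have "z ! p = z ! (p + r)" if p: "p + r < length z" for p
  proof (cases "p + T' < length z")
    case True
    then have "z ! p = z ! (p + T')" using assms by (simp add: periodic_def)
    moreover have "z ! (p + r) = z ! (p + r + c * T)"
      using True T' by (intro periodic_mult[OF T(1)]) simp
    ultimately show ?thesis by (simp add: T' algebra_simps)
  next
    case False
    \<comment> \<open>Here \<open>p + T' \<ge> length z \<ge> 2 * T'\<close>, so
      \<open>p \<ge> T' \<ge> c * T\<close> leaves room to go back first.\<close>
    then have cp: "c * T \<le> p" using assms(3) T' by simp
    then have "z ! (p - c * T) = z ! p"
      using periodic_mult[OF T(1), of "p - c * T" c] p by simp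
    moreover have "z ! (p - c * T) = z ! (p - c * T + T')"
      using assms(2) p cp T' by (simp add: periodic_def)
    ultimately show ?thesis using cp T' by simp
  qed
  then have "periodic r z"
    using r rT T by (auto simp: periodic_def)
  then show False
    using assms rT by (auto simp: min_period_def)
qed

section \<open>Runs of deleted reads and the glued survivors\<close>

text \<open>\<open>inside\<close> says that the read directly after each run exists;
  \<open>spaced\<close> says that at least two reads survive between two runs.\<close>

locale deletion_pattern =
  fixes l k :: nat and i t :: "nat \<Rightarrow> nat" and xt :: "nat list"
  assumes l: "2 \<le> l"
    and inside: "j \<in> {1..k} \<Longrightarrow> i j + t j + l < length xt"
    and spaced: "r \<in> {1..k} \<Longrightarrow> j \<in> {1..k} \<Longrightarrow> r < j \<Longrightarrow> i r + t r + 2 \<le> i j"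
    and len_xt: "l \<le> length xt"
begin

definition win :: "nat \<Rightarrow> nat list" where
  "win e = take l (drop e xt)"

text \<open>This is \<sigma> expressed by the original sequence: the reads just before and just
  after the run. \<open>gaps_start\<close> identifies it with the number read off
  \<open>R'\<close>.\<close>

definition sg :: "nat \<Rightarrow> nat" where
  "sg j = gap l (win (i j)) (win (i j + t j + 1))"

definition del :: "nat set \<Rightarrow> nat set" where
  "del J = (\<Union>j\<in>J. {i j + 1..i j + t j})"

definition blocks :: "nat set \<Rightarrow> nat set" where
  "blocks J = (\<Union>j\<in>J. block l i t sg j)"

lemma length_win: "e + l \<le> length xt \<Longrightarrow> length (win e) = l"
  by (simp add: win_def)

lemma reads_nth: "e + l \<le> length xt \<Longrightarrow> e < length (reads l xt) \<and> reads l xt ! e = win e"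
  by (auto simp: reads_def win_def simp del: upt_Suc)

lemma length_reads: "length (reads l xt) = length xt - l + 1"
  by (simp add: reads_def)

text \<open>The shift by \<open>t j + 1\<close> that really occurs in \<open>xt\<close> is an
  admissible overlap, which bounds the least one.\<close>

lemma sg_le: "j \<in> {1..k} \<Longrightarrow> sg j \<le> min (l - 1) (t j)"
proof -
  assume j: "j \<in> {1..k}"
  have "sg j < l"
    unfolding sg_def using gap_less[OF length_win, of "i j"] inside[OF j] l by simp
  moreover have "sg j \<le> t j"
    unfolding sg_def
    by (rule gap_le) (simp add: win_def drop_take add.commute)
  ultimately show ?thesis by simp
qed

lemma gap_adjacent:
  assumes "Suc e + l \<le> length xt"
  shows "gap l (win e) (win (Suc e)) = 0"
  using gap_le[of 0 "win e" l "win (Suc e)"] by (simp add: win_def drop_take)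

lemma start_not_del: "j \<in> {1..k} \<Longrightarrow> J \<subseteq> {1..k} \<Longrightarrow> i j \<notin> del J"
proof
  assume j: "j \<in> {1..k}" "J \<subseteq> {1..k}" "i j \<in> del J"
  then obtain r where r: "r \<in> J" "i r + 1 \<le> i j" "i j \<le> i r + t r"
    by (auto simp: del_def)
  then show False
    using j spaced[of r j] spaced[of j r] by (cases r j rule: linorder_cases) auto
qed

lemma stop_not_del: "j \<in> {1..k} \<Longrightarrow> J \<subseteq> {1..k} \<Longrightarrow> i j + t j + 1 \<notin> del J"
proof
  assume j: "j \<in> {1..k}" "J \<subseteq> {1..k}" "i j + t j + 1 \<in> del J"
  then obtain r where r: "r \<in> J" "i r + 1 \<le> i j + t j + 1" "i j + t j + 1 \<le> i r + t r"
    by (auto simp: del_def)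
  then show False
    using j spaced[of r j] spaced[of j r] by (cases r j rule: linorder_cases) auto
qed

text \<open>The last bound is not strict so that the range includes the final letter of the read
  after the run.\<close>

lemma block_index_unique:
  assumes "j \<in> {1..k}" "r \<in> {1..k}" "i r + l \<le> p" "p < i r + l + (t r - sg r)"
    "i j + l \<le> p" "p \<le> i j + l + t j"
  shows "r = j"
  using assms spaced[of r j] spaced[of j r] by (cases r j rule: linorder_cases) auto

lemma blocks_iff: "p \<in> blocks J \<longleftrightarrow> (\<exists>r\<in>J. i r + l \<le> p \<and> p < i r + l + (t r - sg r))"
  by (auto simp: blocks_def block_def)

text \<open>Stated for prefixes and for an arbitrary set \<open>J\<close> of runs, because the second conjunct then
  yields that the read \<open>win e\<close> survives the deletion of the blocks in \<open>J\<close>.\<close>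

lemma merge_survivors:
  assumes J: "J \<subseteq> {1..k}" and "e \<notin> del J" "e + l \<le> length xt"
  shows "merge l (delete_positions (take (Suc e) (reads l xt)) (del J)) =
           delete_positions (take (e + l) xt) (blocks J) \<and>
         (\<exists>R. delete_positions (take (Suc e) (reads l xt)) (del J) = R @ [win e])"
  using assms(2,3)
proof (induction e rule: less_induct)
  case (less e)
  let ?R = "\<lambda>e. delete_positions (take e (reads l xt)) (del J)"
  let ?Z = "\<lambda>e. delete_positions (take e xt) (blocks J)"
  have Re: "?R (Suc e) = ?R e @ [win e]"
    using delete_positions_take_keep[of e "Suc e" "del J" "reads l xt"] less.prems reads_nth[of e]
    by (simp add: take_Suc_conv_app_nth hd_drop_conv_nth take_Suc)
  consider "e = 0" | e' where "e = Suc e'" "e' \<notin> del J" | e' where "e = Suc e'" "e' \<in> del J"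
    by (cases e) auto
  then show ?case
  proof cases
    case 1
    have "{0..<l} \<inter> blocks J = {}" by (auto simp: blocks_iff)
    then have "?Z l = ?Z 0 @ take l xt"
      using delete_positions_take_keep[of 0 l "blocks J" xt] len_xt by simp
    then show ?thesis
      using Re 1 by (simp add: delete_positions_def win_def)
  next
    case 2
    obtain R where R: "?R e = R @ [win e']" and IH: "merge l (?R e) = ?Z (e' + l)"
      using less.IH[of e'] less.prems 2 by auto
    \<comment> \<open>This is the position of the single new letter of \<open>win e\<close>; if it
      were in a block, \<open>e\<close> would be in the same run.\<close>
    have "e' + l \<notin> blocks J"
    proof
      assume "e' + l \<in> blocks J"
      then obtain r where r: "r \<in> J" "i r \<le> e'" "e' < i r + t r"
        by (auto simp: blocks_iff)
      then have "e \<in> del J" using 2 unfolding del_def by (auto intro!: bexI[of _ r])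
      then show False using less.prems by simp
    qed
    then have "?Z (e + l) = ?Z (e' + l) @ take 1 (drop (e' + l) xt)"
      using delete_positions_take_keep[of "e' + l" "e + l" "blocks J" xt] less.prems 2 by simp
    moreover have "drop (l - Suc 0) (win e) = take 1 (drop (e' + l) xt)"
      using 2 l by (simp add: win_def drop_take add.commute)
    ultimately show ?thesis
      using R IH Re 2 less.prems
      by (simp add: merge_snoc length_win gap_adjacent)
  next
    case 3
    then obtain j where j: "j \<in> J" "i j + 1 \<le> e'" "e' \<le> i j + t j"
      by (auto simp: del_def)
    \<comment> \<open>As \<open>e - 1\<close> is deleted and \<open>e\<close> is not,
      \<open>e\<close> is the first read after the run. The induction hypothesis is then used at
      \<open>i j\<close>, the last read before it.\<close>
    have "\<not> e \<le> i j + t j"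
      using less.prems j 3 by (auto simp: del_def)
    then have e: "e = i j + t j + 1" using j 3 by simp
    have jk: "j \<in> {1..k}" using j J by blast
    obtain R where R: "?R (Suc (i j)) = R @ [win (i j)]"
      and IH: "merge l (?R (Suc (i j))) = ?Z (i j + l)"
      using less.IH[of "i j"] less.prems e start_not_del[OF jk J] by auto
    have "?R e = ?R (Suc (i j))"
      using j e less.prems length_reads
      by (intro delete_positions_take_remove) (auto simp: del_def)
    then have Re': "?R (Suc e) = R @ [win (i j), win e]"
      using Re R by simp
    have s: "sg j \<le> t j" "sg j < l" using sg_le[OF jk] l by auto
    \<comment> \<open>The first position after the block; from here to the end of
      \<open>win e\<close> there are \<open>sg j + 1\<close> letters, the part of
      \<open>win e\<close> outside the overlap.\<close>
    let ?b = "i j + l + (t j - sg j)"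
    have "?Z ?b = ?Z (i j + l)"
      using j s e less.prems
      by (intro delete_positions_take_remove) (auto simp: blocks_iff intro!: bexI[of _ j])
    moreover have "?Z (e + l) = ?Z ?b @ take (e + l - ?b) (drop ?b xt)"
    proof (rule delete_positions_take_keep)
      show "{?b..<e + l} \<inter> blocks J = {}"
      proof (rule equals0I)
        fix p assume p: "p \<in> {?b..<e + l} \<inter> blocks J"
        then obtain r where r: "r \<in> J" "i r + l \<le> p" "p < i r + l + (t r - sg r)"
          by (auto simp: blocks_iff)
        then have "r = j" using p J e by (intro block_index_unique[OF jk]) auto
        then show False using r p s by auto
      qed
    qed (use e less.prems in auto)
    moreover have "drop (l - Suc (sg j)) (win e) = take (e + l - ?b) (drop ?b xt)"
    proof -
      have "l - Suc (sg j) + e = ?b" "l - (l - Suc (sg j)) = e + l - ?b" using s e by auto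
      then show ?thesis by (simp add: win_def drop_take)
    qed
    moreover have "merge l (?R (Suc e)) = ?Z (i j + l) @ drop (l - Suc (sg j)) (win e)"
      unfolding Re' IH[symmetric] R sg_def e[symmetric]
      by (rule merge_snoc[OF length_win]) (use e less.prems in simp)
    ultimately show ?thesis
      using Re by simp
  qed
qed

text \<open>The entry \<open>e\<close> of a list moves to position \<open>e - card (A \<inter> {..<e})\<close> when the positions in \<open>A\<close> are
  deleted.\<close>

lemma rank_step:
  assumes "e < e'" "e \<notin> A" "{e<..<e'} \<subseteq> A"
  shows "e' - card (A \<inter> {..<e'}) = Suc (e - card (A \<inter> {..<e}))"
proof -
  \<comment> \<open>The new index of a survivor is the number of survivors before it.\<close>
  have rank: "m - card (A \<inter> {..<m}) = card ({..<m} - A)" for m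
    by (simp add: card_Diff_subset_Int Int_commute)
  have "{..<e'} - A = insert e ({..<e} - A)"
    using assms by (auto simp: subset_iff) (meson linorder_neqE_nat)
  then show ?thesis unfolding rank by simp
qed

abbreviation "R' \<equiv> delete_positions (reads l xt) (del {1..k})"

text \<open>By \<open>rank_step\<close> the two reads become neighbours in
  \<open>R'\<close>.\<close>

lemma gaps_eval:
  assumes "e < e'" "e' + l \<le> length xt" "e \<notin> del {1..k}" "e' \<notin> del {1..k}" "{e<..<e'} \<subseteq> del {1..k}"
  shows "gaps l R' (e - card (del {1..k} \<inter> {..<e})) = gap l (win e) (win e')"
proof -
  let ?rank = "\<lambda>e. e - card (del {1..k} \<inter> {..<e})"
  have e: "e < length (reads l xt)" "reads l xt ! e = win e"
    and e': "e' < length (reads l xt)" "reads l xt ! e' = win e'"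
    using assms(1,2) by (simp_all add: reads_nth)
  have "?rank e' = Suc (?rank e)"
    using rank_step[OF assms(1,3,5)] .
  moreover have "R' ! ?rank e = win e" "R' ! ?rank e' = win e'"
    using delete_positions_nth(2)[OF e(1) assms(3)] delete_positions_nth(2)[OF e'(1) assms(4)] e e'
    by argo+
  moreover have "?rank e' < length R'"
    using delete_positions_nth(1)[OF e'(1) assms(4)] .
  ultimately show ?thesis
    unfolding gaps_def by argo
qed

text \<open>Earlier runs lie entirely below \<open>i j\<close>, later ones above it, and
  disjointness lets the lengths add up.\<close>

lemma rank_start:
  assumes j: "j \<in> {1..k}"
  shows "card (del {1..k} \<inter> {..<i j}) = (\<Sum>r = 1..<j. t r)"
proof -
  have *: "r < j" if "r \<in> {1..k}" "i r + 1 \<le> p" "p < i j" for r p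
    using that j spaced[of j r] by (cases r j rule: linorder_cases) auto
  have "del {1..k} \<inter> {..<i j} = (\<Union>r\<in>{1..<j}. {i r + 1..i r + t r})"
    (is "?l = ?r")
  proof
    show "?l \<subseteq> ?r" using * by (fastforce simp: del_def)
    show "?r \<subseteq> ?l" using spaced[OF _ j] j by (fastforce simp: del_def)
  qed
  also have "card \<dots> = (\<Sum>r = 1..<j. card {i r + 1..i r + t r})"
  proof (rule card_UN_disjoint, simp, simp, intro ballI impI)
    fix r s assume rs: "r \<in> {1..<j}" "s \<in> {1..<j}" "r \<noteq> s"
    then show "{i r + 1..i r + t r} \<inter> {i s + 1..i s + t s} = {}"
      using j spaced[of r s] spaced[of s r] by (cases r s rule: linorder_cases) auto
  qed
  finally show ?thesis by simp
qed

lemma gaps_start: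
  assumes j: "j \<in> {1..k}"
  shows "gaps l R' (i j - (\<Sum>r = 1..<j. t r)) = sg j"
  unfolding rank_start[OF j, symmetric] sg_def
proof (rule gaps_eval)
  show "{i j<..<i j + t j + 1} \<subseteq> del {1..k}"
    using j by (auto simp: del_def intro!: bexI[of _ j])
  show "i j + t j + 1 + l \<le> length xt" using inside[OF j] by simp
qed (use start_not_del[OF j] stop_not_del[OF j] in \<open>simp_all del: One_nat_def\<close>)

text \<open>Such an entry is either the last one or is still followed by its original successor,
  with which it shares \<open>l - 1\<close> letters.\<close>

lemma gaps_elsewhere:
  assumes "\<forall>j\<in>{1..k}. p \<noteq> i j - (\<Sum>r = 1..<j. t r)"
  shows "gaps l R' p = 0"
proof (cases "Suc p < length R'")
  case True
  then obtain e where e: "e < length (reads l xt)" "e \<notin> del {1..k}" "p = e - card (del {1..k} \<inter> {..<e})"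
    using delete_positions_index[of p] by (metis Suc_lessD)
  have "Suc e < length (reads l xt)"
  proof (rule ccontr)
    assume "\<not> Suc e < length (reads l xt)"
    then have "Suc e = length (reads l xt)" using e by simp
    then have "length R' = Suc e - card (del {1..k} \<inter> {..<Suc e})"
      using length_delete_positions_take[of "Suc e" "reads l xt" "del {1..k}"] by simp
    also have "\<dots> = Suc p" using e rank_step[of e "Suc e" "del {1..k}"] by fastforce
    finally show False using True by simp
  qed
  then have e': "Suc e + l \<le> length xt" using length_reads len_xt by simp
  have "Suc e \<notin> del {1..k}"
  proof
    assume "Suc e \<in> del {1..k}"
    then obtain j where j: "j \<in> {1..k}" "i j \<le> e" "e < i j + t j" by (auto simp: del_def)
    moreover have "\<not> (i j + 1 \<le> e \<and> e \<le> i j + t j)"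
      using e(2) j(1) by (auto simp: del_def simp del: One_nat_def)
    ultimately have "e = i j" by simp
    then show False using assms e(3) j(1) rank_start by auto
  qed
  then show ?thesis
    using gaps_eval[of e "Suc e"] e e' gap_adjacent[of e] by fastforce
qed (simp add: gaps_def)

text \<open>The case of \<open>merge_survivors\<close> for the last read, which survives by
  \<open>inside\<close>.\<close>

lemma merge_R': "merge l R' = delete_positions xt (blocks {1..k})"
proof -
  have "length xt - l \<notin> del {1..k}"
    using inside by (fastforce simp: del_def)
  then show ?thesis
    using merge_survivors[of "{1..k}" "length xt - l"] len_xt length_reads by simp
qed

section \<open>Periodicity around a block in the intermediate sequences\<close>

text \<open>Links \<open>block_start\<close> to the number of positions deleted before the
  block.\<close>

lemma card_blocks:
  assumes j: "j \<in> {1..k}" and J: "J \<subseteq> {1..k}"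
  shows "card (blocks J \<inter> {..<i j + l}) = (\<Sum>r | r \<in> J \<and> r < j. t r - sg r)"
proof -
  have fin: "finite J" using J finite_subset by blast
  have eq: "blocks J \<inter> {..<i j + l} = (\<Union>r\<in>{r \<in> J. r < j}. block l i t sg r)" (is "?l = ?r")
  proof
    show "?l \<subseteq> ?r"
    proof
      fix p assume "p \<in> ?l"
      then obtain r where r: "r \<in> J" "i r + l \<le> p" "p < i r + l + (t r - sg r)" "p < i j + l"
        by (auto simp: blocks_iff)
      moreover have "r < j"
        using r j J spaced[of j r] by (cases r j rule: linorder_cases) auto
      ultimately show "p \<in> ?r" by (auto simp: block_def)
    qed
    show "?r \<subseteq> ?l"
    proof
      fix p assume "p \<in> ?r"
      then obtain r where r: "r \<in> J" "r < j" "i r + l \<le> p" "p < i r + l + (t r - sg r)"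
        by (auto simp: block_def)
      then show "p \<in> ?l"
        using spaced[of r j] j J by (auto simp: blocks_iff)
    qed
  qed
  have "card ?r = (\<Sum>r | r \<in> J \<and> r < j. card (block l i t sg r))"
  proof (rule card_UN_disjoint, use fin in simp, simp add: block_def, intro ballI impI)
    fix r s assume rs: "r \<in> {r \<in> J. r < j}" "s \<in> {r \<in> J. r < j}" "r \<noteq> s"
    then have "r \<in> {1..k}" "s \<in> {1..k}" using J by auto
    then show "block l i t sg r \<inter> block l i t sg s = {}"
      using rs spaced[of r s] spaced[of s r] by (cases r s rule: linorder_cases) (auto simp: block_def)
  qed
  then show ?thesis by (simp add: eq) (simp add: block_def)
qed

text \<open>Earlier blocks may overlap the positions of \<open>win (i j)\<close>, so this factor is
  not simply copied. Still, the glued reads up to \<open>i j\<close> end in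
  \<open>win (i j)\<close>, and no block of \<open>J\<close> meets the \<open>t j + 1\<close>
  positions that follow.\<close>

lemma neighbourhood_preserved:
  assumes j: "j \<in> {1..k}" and J: "J \<subseteq> {1..k} - {j}"
  obtains w y where "delete_positions xt (blocks J) = w @ take (l + t j + 1) (drop (i j) xt) @ y"
    "block_start l i t sg J j = length w + l"
proof -
  have J': "J \<subseteq> {1..k}" using J by blast
  let ?Z = "\<lambda>e. delete_positions (take e xt) (blocks J)"
  have inj: "i j + t j + l < length xt" using inside[OF j] .
  have "\<exists>R. delete_positions (take (Suc (i j)) (reads l xt)) (del J) = R @ [win (i j)]"
    and Z: "merge l (delete_positions (take (Suc (i j)) (reads l xt)) (del J)) = ?Z (i j + l)"
    using merge_survivors[OF J', of "i j"] start_not_del[OF j J'] inj by auto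
  then obtain w where w: "?Z (i j + l) = w @ win (i j)"
    using merge_snoc_suffix by metis
  have "{i j + l..<i j + l + t j + 1} \<inter> blocks J = {}"
  proof (rule equals0I)
    fix p assume p: "p \<in> {i j + l..<i j + l + t j + 1} \<inter> blocks J"
    then obtain r where r: "r \<in> J" "i r + l \<le> p" "p < i r + l + (t r - sg r)"
      by (auto simp: blocks_iff)
    then have "r = j" using p J' by (intro block_index_unique[OF j]) auto
    then show False using r J by auto
  qed
  then have "?Z (i j + l + t j + 1) = ?Z (i j + l) @ take (t j + 1) (drop (i j + l) xt)"
    using delete_positions_take_keep[of "i j + l" "i j + l + t j + 1" "blocks J" xt] inj by simp
  also have "\<dots> = w @ take (l + t j + 1) (drop (i j) xt)"
    unfolding w using take_add[of l "t j + 1" "drop (i j) xt"]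
    by (simp add: win_def add.commute[of "i j" l])
  finally obtain y where y: "delete_positions xt (blocks J) = w @ take (l + t j + 1) (drop (i j) xt) @ y"
    using delete_positions_take_prefix[of xt "blocks J" "i j + l + t j + 1"] by auto
  have "length (?Z (i j + l)) = i j + l - (\<Sum>r | r \<in> J \<and> r < j. t r - sg r)"
    using length_delete_positions_take[of "i j + l" xt "blocks J"] card_blocks[OF j J'] inj by simp
  moreover have "length (?Z (i j + l)) = length w + l"
    unfolding w using length_win[of "i j"] inj by simp
  ultimately have "block_start l i t sg J j = length w + l"
    by (simp add: block_start_def)
  with y show thesis using that by blast
qed

text \<open>The overlap equates letters at distance \<open>t j - sg j\<close>. The bound by
  \<open>l - 1\<close> makes it nonempty, the bound by \<open>t j\<close> makes the distance
  positive.\<close>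

lemma overlap_periodic:
  assumes j: "j \<in> {1..k}" and lt: "sg j < min (l - 1) (t j)"
  shows "periodic (t j - sg j) (substr xt (i j + sg j + 1) (i j + l + (t j - sg j)))"
proof -
  have inj: "i j + t j + l < length xt" using inside[OF j] .
  have ov: "drop (Suc (sg j)) (win (i j)) = take (l - Suc (sg j)) (win (i j + t j + 1))"
    unfolding sg_def using gap_overlap length_win inj by simp
  have "xt ! p = xt ! (p + (t j - sg j))"
    if p: "i j + sg j + 1 \<le> p" "p + (t j - sg j) < i j + l + (t j - sg j)" for p
  proof -
    define d where "d = p - (i j + sg j + 1)"
    have d: "p = i j + sg j + 1 + d" "d < l - Suc (sg j)" using p by (auto simp: d_def)
    have "drop (Suc (sg j)) (win (i j)) ! d = xt ! p"
      using d inj by (simp add: win_def add.assoc)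
    moreover have "take (l - Suc (sg j)) (win (i j + t j + 1)) ! d = xt ! (p + (t j - sg j))"
      using d inj lt by (simp add: win_def) (simp add: add_ac)
    ultimately show ?thesis using ov by simp
  qed
  then show ?thesis
    using lt inj by (subst periodic_substr_iff) auto
qed

lemma maximal_periodic_around:
  assumes j: "j \<in> {1..k}" and lt: "sg j < min (l - 1) (t j)"
  shows "\<exists>T. \<forall>J. J \<subseteq> {1..k} - {j} \<longrightarrow>
    (let z = delete_positions xt (blocks J); s = block_start l i t sg J j
     in \<exists>a b. maximal_periodic z T a b \<and> min_period T (substr z a b) \<and>
          a \<le> s \<and> s + (t j - sg j) \<le> b \<and> l - 1 + t j - 2 * sg j \<le> b - a \<and>
          T \<le> t j - sg j \<and> (t j \<le> l - 2 \<longrightarrow> T dvd t j - sg j))"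
proof -
  let ?P = "substr xt (i j + sg j + 1) (i j + l + (t j - sg j))"
  have inj: "i j + t j + l < length xt" using inside[OF j] .
  have per: "periodic (t j - sg j) ?P" using overlap_periodic[OF assms] .
  \<comment> \<open>\<open>T\<close> comes from the factor \<open>?P\<close> of \<open>xt\<close>,
    before \<open>J\<close> is fixed, so it serves all intermediate sequences at once.\<close>
  obtain T where T: "min_period T ?P" "T \<le> t j - sg j"
    using min_period_exists[OF per] .
  \<comment> \<open>\<open>?P\<close> has length \<open>l - 1 + t j - 2 * sg j\<close>, which is at
    least twice \<open>t j - sg j\<close> under this bound.\<close>
  have dvd: "T dvd t j - sg j" if "t j \<le> l - 2"
    by (rule min_period_dvd[OF T(1) per]) (use that lt inj in \<open>simp add: length_substr\<close>)
  show ?thesis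
  proof (intro exI[of _ T] allI impI, unfold Let_def)
    fix J assume J: "J \<subseteq> {1..k} - {j}"
    obtain w y where z: "delete_positions xt (blocks J) = w @ take (l + t j + 1) (drop (i j) xt) @ y"
      and s: "block_start l i t sg J j = length w + l"
      using neighbourhood_preserved[OF j J] .
    let ?z = "delete_positions xt (blocks J)"
    have len: "length w + l + (t j - sg j) \<le> length ?z" using inj by (simp add: z)
    \<comment> \<open>The factor \<open>?P\<close> reappears in the intermediate sequence, with
      \<open>length w\<close> in the place of \<open>i j\<close>.\<close>
    have "substr ?z (length w + sg j + 1) (length w + l + (t j - sg j)) = ?P"
    proof (rule nth_equalityI)
      fix p assume "p < length (substr ?z (length w + sg j + 1) (length w + l + (t j - sg j)))"
      then have p: "p < l + (t j - sg j) - (sg j + 1)" using len by (simp add: length_substr)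
      then show "substr ?z (length w + sg j + 1) (length w + l + (t j - sg j)) ! p = ?P ! p"
        using inj len lt by (simp add: substr_nth) (auto simp: z nth_append add.assoc)
    qed (use len inj in \<open>simp add: length_substr\<close>)
    then have min: "min_period T (substr ?z (length w + sg j + 1) (length w + l + (t j - sg j)))"
      using T by argo
    have le: "length w + sg j + 1 \<le> length w + l + (t j - sg j)"
      using lt unfolding min_less_iff_conj by linarith
    obtain a b where ab: "maximal_periodic ?z T a b" "min_period T (substr ?z a b)"
      "a \<le> length w + sg j + 1" "length w + l + (t j - sg j) \<le> b"
      by (rule min_period_extend[OF min le len])
    show "\<exists>a b. maximal_periodic ?z T a b \<and> min_period T (substr ?z a b) \<and>
          a \<le> block_start l i t sg J j \<and> block_start l i t sg J j + (t j - sg j) \<le> b \<and>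
          l - 1 + t j - 2 * sg j \<le> b - a \<and>
          T \<le> t j - sg j \<and> (t j \<le> l - 2 \<longrightarrow> T dvd t j - sg j)"
      unfolding s using ab T dvd lt by (intro exI[of _ a] exI[of _ b]) auto
  qed
qed

end

lemma spaced_increasing:
  fixes i t :: "nat \<Rightarrow> nat"
  assumes "\<forall>j. 1 \<le> j \<and> j < k \<longrightarrow> i j + t j + 2 \<le> i (j + 1)" "1 \<le> r" "r < j" "j \<le> k"
  shows "i r + t r + 2 \<le> i j"
  using assms(3,4)
proof (induction j)
  case (Suc j)
  then have "i r + t r + 2 \<le> i (j + 1)" if "r = j"
    using assms(1,2) that by auto
  moreover have "i j + t j + 2 \<le> i (j + 1)"
    using assms(1,2) Suc.prems by auto
  ultimately show ?case
    using Suc by (cases "r = j") auto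
qed simp

theorem mainTheorem13:
  fixes q l :: nat
  assumes "2 \<le> q" and "2 \<le> l"
  shows "\<exists>D :: nat list list \<Rightarrow> nat \<Rightarrow> nat.
    \<forall>(n::nat) (u::nat list) (x::nat list) (v::nat list) (k::nat) (i::nat \<Rightarrow> nat) (t::nat \<Rightarrow> nat).
      u \<in> words q l \<and> x \<in> words q n \<and> v \<in> words q l \<and>
      (\<forall>j\<in>{1..k}. 1 \<le> t j) \<and>
      (1 \<le> k \<longrightarrow> i k + t k < n + l) \<and>
      (\<forall>j. 1 \<le> j \<and> j < k \<longrightarrow> i j + t j + 2 \<le> i (j + 1)) \<longrightarrow>
      (let xt = u @ x @ v;
           R' = delete_positions (reads l xt) (\<Union>j\<in>{1..k}. {i j + 1..i j + t j});
           m = (\<lambda>j. \<Sum>r = 1..<j. t r)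
       in \<exists>\<sigma> :: nat \<Rightarrow> nat.
            (\<forall>j\<in>{1..k}. \<sigma> j = D R' (i j - m j)) \<and>
            (\<forall>p. (\<forall>j\<in>{1..k}. p \<noteq> i j - m j) \<longrightarrow> D R' p = 0) \<and>
            (\<forall>j\<in>{1..k}. \<sigma> j \<le> min (l - 1) (t j)) \<and>
            (\<exists>R''. insertion q l (D R') R' R'' \<and> consistent R'') \<and>
            (\<forall>R''. insertion q l (D R') R' R'' \<and> consistent R'' \<longrightarrow>
                   unread R'' = delete_blocks l i t \<sigma> {1..k} xt) \<and>
            (\<forall>j\<in>{1..k}. \<sigma> j < min (l - 1) (t j) \<longrightarrow>
               (\<exists>T. \<forall>J. J \<subseteq> {1..k} - {j} \<longrightarrow>
                 (let z = delete_blocks l i t \<sigma> J xt;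
                      s = block_start l i t \<sigma> J j
                  in \<exists>a b. maximal_periodic z T a b \<and>
                           min_period T (substr z a b) \<and>
                           a \<le> s \<and> s + (t j - \<sigma> j) \<le> b \<and>
                           l - 1 + t j - 2 * \<sigma> j \<le> b - a \<and>
                           T \<le> t j - \<sigma> j \<and>
                           (t j \<le> l - 2 \<longrightarrow> T dvd t j - \<sigma> j)))))"
\<comment> \<open>\<open>D\<close> is fixed before the sequence and the deletions, so the \<sigma>
  depend on the received vector alone.\<close>
proof (rule exI[of _ "gaps l"], intro allI impI, elim conjE)
  fix n k :: nat and u x v :: "nat list" and i t :: "nat \<Rightarrow> nat"
  assume u: "u \<in> words q l" and x: "x \<in> words q n" and v: "v \<in> words q l"
    and last: "1 \<le> k \<longrightarrow> i k + t k < n + l"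
    and sp: "\<forall>j. 1 \<le> j \<and> j < k \<longrightarrow> i j + t j + 2 \<le> i (j + 1)"
  define xt where "xt = u @ x @ v"
  have xt: "length xt = n + 2 * l" "set xt \<subseteq> {..<q}"
    using u x v by (auto simp: xt_def words_def)
  interpret deletion_pattern l k i t xt
  proof
    fix j assume j: "j \<in> {1..k}"
    \<comment> \<open>The bound is given for the last run; the spacing carries it over to the
      earlier ones.\<close>
    show "i j + t j + l < length xt"
      using spaced_increasing[OF sp, of j k] j last xt by (cases "j = k") auto
  qed (use assms xt spaced_increasing[OF sp] in auto)
  have R'_words: "set R' \<subseteq> words q l"
  proof -
    have "set R' \<subseteq> set (reads l xt)"
      unfolding delete_positions_def by (rule set_nths_subset)
    also have "\<dots> \<subseteq> words q l"
      using xt by (auto simp: reads_def words_def dest!: in_set_takeD in_set_dropD)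
    finally show ?thesis .
  qed
  have R': "R' = delete_positions (reads l xt) (\<Union>j\<in>{1..k}. {i j + 1..i j + t j})"
    by (simp add: del_def)
  have blocks: "delete_blocks l i t sg J xt = delete_positions xt (blocks J)" for J
    by (simp add: delete_blocks_def blocks_def)
  show "let xt = u @ x @ v;
           R' = delete_positions (reads l xt) (\<Union>j\<in>{1..k}. {i j + 1..i j + t j});
           m = (\<lambda>j. \<Sum>r = 1..<j. t r)
       in \<exists>\<sigma> :: nat \<Rightarrow> nat.
            (\<forall>j\<in>{1..k}. \<sigma> j = gaps l R' (i j - m j)) \<and>
            (\<forall>p. (\<forall>j\<in>{1..k}. p \<noteq> i j - m j) \<longrightarrow> gaps l R' p = 0) \<and>
            (\<forall>j\<in>{1..k}. \<sigma> j \<le> min (l - 1) (t j)) \<and>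
            (\<exists>R''. insertion q l (gaps l R') R' R'' \<and> consistent R'') \<and>
            (\<forall>R''. insertion q l (gaps l R') R' R'' \<and> consistent R'' \<longrightarrow>
                   unread R'' = delete_blocks l i t \<sigma> {1..k} xt) \<and>
            (\<forall>j\<in>{1..k}. \<sigma> j < min (l - 1) (t j) \<longrightarrow>
               (\<exists>T. \<forall>J. J \<subseteq> {1..k} - {j} \<longrightarrow>
                 (let z = delete_blocks l i t \<sigma> J xt;
                      s = block_start l i t \<sigma> J j
                  in \<exists>a b. maximal_periodic z T a b \<and>
                           min_period T (substr z a b) \<and>
                           a \<le> s \<and> s + (t j - \<sigma> j) \<le> b \<and>
                           l - 1 + t j - 2 * \<sigma> j \<le> b - a \<and>
                           T \<le> t j - \<sigma> j \<and>
                           (t j \<le> l - 2 \<longrightarrow> T dvd t j - \<sigma> j))))"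
    \<comment> \<open>Only the outer bindings are unfolded; the inner \<open>let\<close> stays as in
      \<open>maximal_periodic_around\<close>.\<close>
    unfolding xt_def[symmetric] Let_def[of xt] Let_def[of "delete_positions _ _"] Let_def[of "\<lambda>j. \<Sum>r = 1..<j. t r"]
      R'[symmetric]
  proof (rule exI[of _ sg], unfold blocks, intro conjI)
    show "\<forall>j\<in>{1..k}. sg j = gaps l R' (i j - (\<Sum>r = 1..<j. t r))"
      using gaps_start by simp
    show "\<forall>p. (\<forall>j\<in>{1..k}. p \<noteq> i j - (\<Sum>r = 1..<j. t r)) \<longrightarrow> gaps l R' p = 0"
      using gaps_elsewhere by simp
    show "\<forall>j\<in>{1..k}. sg j \<le> min (l - 1) (t j)"
      using sg_le by blast
    show "\<exists>R''. insertion q l (gaps l R') R' R'' \<and> consistent R''"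
      by (rule consistent_insertion_exists[OF R'_words]) (use assms in simp)
    show "\<forall>R''. insertion q l (gaps l R') R' R'' \<and> consistent R'' \<longrightarrow>
        unread R'' = delete_positions xt (blocks {1..k})"
    proof (intro allI impI, elim conjE)
      fix R'' assume "insertion q l (gaps l R') R' R''" "consistent R''"
      then have "unread R'' = merge l R'"
        by (rule unread_insertion) (use R'_words assms in \<open>auto simp: words_def\<close>)
      then show "unread R'' = delete_positions xt (blocks {1..k})"
        by (simp only: merge_R')
    qed
  qed (intro ballI impI, rule maximal_periodic_around)
qed

end
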